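(* Let $Z$ be the unit ball in $\ell^1$, i.e. the set of real sequences $z=(z_1,z_2,\ldots)$ with $\sum_i|z_i|\le1$, endowed with the $\ell^1$-metric. For $q>\frac12$ there does not exist a $q$-snowflake map $f:Z\to Y$ where $Y$ is a metric space satisfying the Ptolemy inequality.
   Context: Distances are written $|zz'|$. A map $f:Z\to Y$ is a $q$-snowflake map (also called a $q$-snowflake embedding) if there exists $c>1$ such that for all $z,z'\in Z$ $$\frac1c|zz'|^q\le|f(z)f(z')|\le c|zz'|^q.$$ A metric space $Y$ satisfies the Ptolemy inequality if for all $y_1,y_2,y_3,y_4\in Y$ $$|y_1y_3|\,|y_2y_4|\le|y_1y_2|\,|y_3y_4|+|y_2y_3|\,|y_4y_1|.$$ *)

theory Defs
  imports "HOL-Analysis.Analysis"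
begin

(* Real sequences are indexed from 0 instead of 1.  Summability is stated
   explicitly because suminf carries no information on divergent series. *)
definition l1_unit_ball :: "(nat \<Rightarrow> real) set" where
  "l1_unit_ball = {z. summable (\<lambda>i. \<bar>z i\<bar>) \<and> (\<Sum>i. \<bar>z i\<bar>) \<le> 1}"

definition l1_dist :: "(nat \<Rightarrow> real) \<Rightarrow> (nat \<Rightarrow> real) \<Rightarrow> real" where
  "l1_dist z w = (\<Sum>i. \<bar>z i - w i\<bar>)"

(* Metric spaces are given by a carrier and a distance function, as in the
   library locale Metric_space.  Note that 0 powr q = 0. *)
definition snowflake_map ::
    "real \<Rightarrow> 'a set \<Rightarrow> ('a \<Rightarrow> 'a \<Rightarrow> real) \<Rightarrow> 'b set \<Rightarrow> ('b \<Rightarrow> 'b \<Rightarrow> real) \<Rightarrow> ('a \<Rightarrow> 'b) \<Rightarrow> bool" where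
  "snowflake_map q Z dZ Y dY f \<longleftrightarrow>
     f \<in> Z \<rightarrow> Y \<and>
     (\<exists>c>1. \<forall>z\<in>Z. \<forall>z'\<in>Z.
        1 / c * dZ z z' powr q \<le> dY (f z) (f z') \<and>
        dY (f z) (f z') \<le> c * dZ z z' powr q)"

definition ptolemy_inequality :: "'b set \<Rightarrow> ('b \<Rightarrow> 'b \<Rightarrow> real) \<Rightarrow> bool" where
  "ptolemy_inequality Y d \<longleftrightarrow>
     (\<forall>y1\<in>Y. \<forall>y2\<in>Y. \<forall>y3\<in>Y. \<forall>y4\<in>Y.
        d y1 y3 * d y2 y4 \<le> d y1 y2 * d y3 y4 + d y2 y3 * d y4 y1)"

end

theory Submission
  imports Defs "HOL-Library.Ramsey"
begin

text \<open>Write \<open>D\<close> for the distance in \<open>Y\<close> between images of points of the ball. Suppose a cube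
  \<open>{0,1}\<^sup>k\<close>, whose edges have \<open>\<ell>\<^sup>1\<close>-length \<open>2 / k\<close>, sits in the ball so that \<open>D\<close> is invariant under
  all coordinate flips, and let \<open>v m\<close> be the distance from \<open>0\<close> to the vertex whose first \<open>m\<close>
  coordinates are \<open>1\<close>. In the quadrilateral spanned at \<open>0\<close> by that vertex and the next edge, both
  diagonals are \<open>v (m + 1)\<close>, two opposite sides are \<open>v m\<close>, and the other two have length
  \<open>O(k powr - q)\<close>. The Ptolemy inequality gives \<open>(v (m + 1))\<^sup>2 \<le> (v m)\<^sup>2 + O(k powr (- 2 * q))\<close>, so
  \<open>(v k)\<^sup>2 = O(k powr (1 - 2 * q))\<close> while \<open>v k\<close> is bounded below: impossible for large \<open>k\<close> if \<open>q > 1 / 2\<close>.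

  The vertices are scaled indicators of sets that, in each of \<open>k\<close> consecutive blocks of indices, contain
  every second index, with parity given by the coordinate. By Ramsey's theorem one may assume that
  \<open>D\<close> depends, up to a small error, only on the relative order of the indices involved. Moving a block by
  one index preserves that order; it flips the coordinate of the block, up to one index.\<close>

section \<open>Ramsey's theorem for bounded real-valued functions\<close>

text \<open>Colour an \<open>r\<close>-set by which of the finitely many bins of width
  \<open>\<eta>\<close> contains the value of \<open>F\<close> on its increasing enumeration. Then
  \<open>y\<close> enumerates an infinite monochromatic set.\<close>

lemma ramsey_real_sequence:
  fixes F :: "(nat \<Rightarrow> nat) \<Rightarrow> real"
  assumes local: "\<And>g h. (\<And>l. l < r \<Longrightarrow> g l = h l) \<Longrightarrow> F g = F h"
    and nonneg: "\<And>h. 0 \<le> F h" and bound: "\<And>h. F h \<le> M" and "\<eta> > 0"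
  obtains y :: "nat \<Rightarrow> nat" where "strict_mono y"
    "\<And>g h. strict_mono g \<Longrightarrow> strict_mono h \<Longrightarrow> \<bar>F (y \<circ> g) - F (y \<circ> h)\<bar> \<le> \<eta>"
proof -
  define col where "col X = nat \<lfloor>F (\<lambda>l. sorted_list_of_set X ! l) / \<eta>\<rfloor>" for X
  have col_bound: "col X < nat \<lfloor>M / \<eta>\<rfloor> + 1" for X
  proof -
    have "F (\<lambda>l. sorted_list_of_set X ! l) / \<eta> \<le> M / \<eta>"
      using bound \<open>\<eta> > 0\<close> by (simp add: divide_right_mono)
    then have "col X \<le> nat \<lfloor>M / \<eta>\<rfloor>"
      unfolding col_def by (intro nat_mono floor_mono)
    then show ?thesis by simp
  qed
  obtain Y t where Y: "infinite (Y :: nat set)"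
    and mono_col: "\<And>X. X \<subseteq> Y \<Longrightarrow> finite X \<Longrightarrow> card X = r \<Longrightarrow> col X = t"
    using Ramsey[of "UNIV :: nat set" r col "nat \<lfloor>M / \<eta>\<rfloor> + 1"] col_bound by auto
  define y where "y = enumerate Y"
  have y: "strict_mono y" "range y = Y"
    using Y by (simp_all add: y_def strict_mono_enumerate range_enumerate)
  have floor_eq: "nat \<lfloor>F (y \<circ> g) / \<eta>\<rfloor> = t" if "strict_mono g" for g
  proof -
    let ?X = "(y \<circ> g) ` {..<r}"
    have sm: "strict_mono (y \<circ> g)"
      using y that by (simp add: strict_mono_o)
    then have "inj_on (y \<circ> g) {..<r}"
      using inj_on_subset strict_mono_imp_inj_on by blast
    then have "card ?X = r" using card_image by fastforce
    moreover have "?X \<subseteq> Y" using y by auto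
    ultimately have "col ?X = t" by (intro mono_col) auto
    moreover have "sorted_list_of_set ?X = map (y \<circ> g) [0..<r]"
    proof (rule strict_sorted_equal)
      show "sorted_wrt (<) (map (y \<circ> g) [0..<r])"
        using sm by (auto simp: sorted_wrt_iff_nth_less strict_mono_def)
    qed (auto simp: lessThan_atLeast0)
    then have "F (\<lambda>l. sorted_list_of_set ?X ! l) = F (y \<circ> g)"
      by (intro local) simp
    ultimately show ?thesis by (simp add: col_def)
  qed
  have "\<bar>F (y \<circ> g) - F (y \<circ> h)\<bar> \<le> \<eta>" if "strict_mono g" "strict_mono h" for g h
  proof -
    \<comment> \<open>Nonnegativity makes \<open>nat\<close> lossless, so equal colours give equal
      floors.\<close>
    have pos: "0 \<le> \<lfloor>F (y \<circ> g') / \<eta>\<rfloor>" for g'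
      using nonneg \<open>\<eta> > 0\<close> by simp
    have "\<lfloor>F (y \<circ> g) / \<eta>\<rfloor> = \<lfloor>F (y \<circ> h) / \<eta>\<rfloor>"
      using floor_eq[OF that(1)] floor_eq[OF that(2)] pos by (metis nat_eq_iff2 nat_0_le)
    then have "\<bar>F (y \<circ> g) / \<eta> - F (y \<circ> h) / \<eta>\<bar> \<le> 1" by linarith
    then have "\<bar>(F (y \<circ> g) - F (y \<circ> h)) / \<eta>\<bar> \<le> 1"
      by (simp add: diff_divide_distrib)
    then show ?thesis using \<open>\<eta> > 0\<close> by (simp add: abs_divide)
  qed
  with y(1) show ?thesis using that by blast
qed

text \<open>Extract once per index. Estimates already obtained for \<open>y\<close> survive passing
  to \<open>y \<circ> z\<close>, because \<open>z \<circ> g\<close> is again strictly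
  increasing.\<close>

lemma ramsey_real_sequence_family:
  fixes F :: "'i \<Rightarrow> (nat \<Rightarrow> nat) \<Rightarrow> real"
  assumes "finite I"
    and local: "\<And>i g h. (\<And>l. l < r \<Longrightarrow> g l = h l) \<Longrightarrow> F i g = F i h"
    and nonneg: "\<And>i h. 0 \<le> F i h" and bound: "\<And>i h. F i h \<le> M" and "\<eta> > 0"
  shows "\<exists>y :: nat \<Rightarrow> nat. strict_mono y \<and> (\<forall>i\<in>I. \<forall>g h. strict_mono g \<longrightarrow> strict_mono h \<longrightarrow>
           \<bar>F i (y \<circ> g) - F i (y \<circ> h)\<bar> \<le> \<eta>)"
  using \<open>finite I\<close>
proof (induction I)
  case empty
  then show ?case using strict_mono_id by blast
next
  case (insert i I)
  then obtain y where y: "strict_mono (y :: nat \<Rightarrow> nat)"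
    and yI: "\<And>i g h. i \<in> I \<Longrightarrow> strict_mono g \<Longrightarrow> strict_mono h \<Longrightarrow>
               \<bar>F i (y \<circ> g) - F i (y \<circ> h)\<bar> \<le> \<eta>"
    by blast
  obtain z where z: "strict_mono (z :: nat \<Rightarrow> nat)"
    and zi: "\<And>g h. strict_mono g \<Longrightarrow> strict_mono h \<Longrightarrow>
               \<bar>F i (y \<circ> (z \<circ> g)) - F i (y \<circ> (z \<circ> h))\<bar> \<le> \<eta>"
  proof (rule ramsey_real_sequence[where F = "\<lambda>h. F i (y \<circ> h)" and r = r and M = M and \<eta> = \<eta>])
    show "F i (y \<circ> g) = F i (y \<circ> h)" if "\<And>l. l < r \<Longrightarrow> g l = h l" for g h
      using that by (intro local) simp
  qed (use nonneg bound \<open>\<eta> > 0\<close> in auto)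
  show ?case
  proof (intro exI[of _ "y \<circ> z"] conjI ballI allI impI)
    show "strict_mono (y \<circ> z)" using y z by (simp add: strict_mono_o)
    fix i' and g h :: "nat \<Rightarrow> nat"
    assume "i' \<in> insert i I" and gh: "strict_mono g" "strict_mono h"
    then show "\<bar>F i' (y \<circ> z \<circ> g) - F i' (y \<circ> z \<circ> h)\<bar> \<le> \<eta>"
      using zi[OF gh] yI[of i' "z \<circ> g" "z \<circ> h"] z
      by (auto simp: o_assoc[symmetric] strict_mono_o)
  qed
qed

section \<open>Scaled indicators of finite sets in the ball\<close>

lemma l1_dist_scaled_indicator:
  assumes "finite A" "finite B" "u \<ge> 0"
  shows "l1_dist (\<lambda>x. u * indicator A x) (\<lambda>x. u * indicator B x)
         = u * real (card (A - B) + card (B - A))"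
proof -
  have "l1_dist (\<lambda>x. u * indicator A x) (\<lambda>x. u * indicator B x)
      = (\<Sum>x\<in>A \<union> B. \<bar>u * indicator A x - u * indicator B x\<bar>)"
    unfolding l1_dist_def using assms by (intro suminf_finite) auto
  also have "\<dots> = (\<Sum>x\<in>A \<union> B. u * (indicator (A - B) x + indicator (B - A) x))"
    using assms by (intro sum.cong) (auto simp: indicator_def)
  also have "\<dots> = u * ((\<Sum>x\<in>A \<union> B. indicator (A - B) x) + (\<Sum>x\<in>A \<union> B. indicator (B - A) x))"
    by (simp add: sum_distrib_left[symmetric] sum.distrib)
  also have "(\<Sum>x\<in>A \<union> B. indicator (A - B) x) = real (card (A - B))"
    using assms by (auto simp: indicator_def Int_def intro!: arg_cong[where f = card])
  also have "(\<Sum>x\<in>A \<union> B. indicator (B - A) x) = real (card (B - A))"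
    using assms by (auto simp: indicator_def Int_def intro!: arg_cong[where f = card])
  finally show ?thesis by simp
qed

lemma scaled_indicator_in_l1_unit_ball:
  assumes "finite A" "u \<ge> 0" "u * real (card A) \<le> 1"
  shows "(\<lambda>x. u * indicator A x) \<in> l1_unit_ball"
proof -
  have "(\<Sum>x. \<bar>u * indicator A x\<bar>) = (\<Sum>x\<in>A. \<bar>u * indicator A x\<bar>)"
    using assms by (intro suminf_finite) auto
  also have "\<dots> = u * real (card A)"
    using assms by simp
  finally have "(\<Sum>x. \<bar>u * indicator A x\<bar>) \<le> 1" using assms by simp
  moreover have "summable (\<lambda>x. \<bar>u * indicator A x\<bar>)"
    using assms by (intro summable_finite[of A]) auto
  ultimately show ?thesis by (simp add: l1_unit_ball_def)
qed

section \<open>Combs and their differences\<close>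

text \<open>The index range of \<open>h\<close> is cut into \<open>k\<close> blocks of length \<open>2 * N\<close>; in block \<open>i\<close> every second
  index is taken, starting at offset \<open>t i\<close>. Offsets \<open>0\<close> and \<open>1\<close> encode the vertices of a cube.\<close>

definition comb :: "(nat \<Rightarrow> nat) \<Rightarrow> nat \<Rightarrow> nat \<Rightarrow> (nat \<Rightarrow> nat) \<Rightarrow> nat set" where
  "comb h N k t = (\<lambda>n. h (2 * n + t (n div N))) ` {..<k * N}"

lemma finite_comb [simp]: "finite (comb h N k t)"
  by (simp add: comb_def)

lemma card_comb_le: "card (comb h N k t) \<le> k * N"
  unfolding comb_def by (rule order.trans[OF card_image_le]) auto

text \<open>Supplies the dependence on finitely many values that the Ramsey argument demands, with
  \<open>r = 2 * k * N\<close>.\<close>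

lemma comb_cong:
  assumes "\<And>l. l < 2 * k * N \<Longrightarrow> g l = h l" "\<And>i. t i \<le> 1"
  shows "comb g N k t = comb h N k t"
  unfolding comb_def
proof (intro image_cong refl)
  fix n assume "n \<in> {..<k * N}"
  then have "2 * n + t (n div N) < 2 * k * N"
    using assms(2)[of "n div N"] by auto
  then show "g (2 * n + t (n div N)) = h (2 * n + t (n div N))" by (rule assms(1))
qed

text \<open>Skipping one index in front of the blocks with \<open>s i = 1\<close>, and one after those with \<open>s i = 0\<close>,
  is what turns order invariance into invariance under flipping blocks of the cube.\<close>

definition block_shift :: "nat \<Rightarrow> (nat \<Rightarrow> nat) \<Rightarrow> nat \<Rightarrow> nat" where
  "block_shift N s l = l + l div (2 * N) + s (l div (2 * N))"

text \<open>On entering a later block, \<open>l div (2 * N)\<close> gains at least 1, which makes up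
  for a drop of \<open>s\<close> from 1 to 0.\<close>

lemma strict_mono_block_shift:
  assumes "\<And>i. s i \<le> 1"
  shows "strict_mono (block_shift N s)"
proof (rule strict_monoI)
  fix l l' :: nat assume "l < l'"
  then have "l div (2 * N) \<le> l' div (2 * N)" by (simp add: div_le_mono)
  moreover note assms[of "l div (2 * N)"] \<open>l < l'\<close>
  ultimately show "block_shift N s l < block_shift N s l'"
    by (cases "l div (2 * N) = l' div (2 * N)") (auto simp: block_shift_def)
qed

text \<open>An offset of at most 1 never leaves its block, so tooth \<open>n\<close> is displaced by
  the shift of block \<open>n div N\<close>. The summand \<open>i\<close> is the drift from the
  indices skipped earlier.\<close>

lemma comb_block_shift:
  assumes "\<And>i. t i \<le> 1"
  shows "comb (y \<circ> block_shift N s) N k t = comb y N k (\<lambda>i. i + s i + t i)"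
  unfolding comb_def
proof (intro image_cong refl)
  fix n
  have "(2 * n + t (n div N)) div 2 = n"
    using assms[of "n div N"] by linarith
  then have "(2 * n + t (n div N)) div (2 * N) = n div N" by (simp only: div_mult2_eq)
  then show "(y \<circ> block_shift N s) (2 * n + t (n div N))
      = y (2 * n + (n div N + s (n div N) + t (n div N)))"
    by (simp add: block_shift_def algebra_simps)
qed

text \<open>Across a block boundary \<open>2 * n\<close> gains at least 2 and the drift at least 1,
  more than \<open>t\<close> can lose. Offset 2 must be allowed because offsets of two vertices get
  added.\<close>

lemma strict_mono_comb_index:
  fixes N :: nat
  assumes "\<And>i. t i \<le> (2 :: nat)"
  shows "strict_mono (\<lambda>n. 2 * n + (n div N + t (n div N)))"
proof (rule strict_monoI)
  fix n n' :: nat assume "n < n'"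
  then have "n div N \<le> n' div N" by (simp add: div_le_mono)
  moreover note assms[of "n div N"] \<open>n < n'\<close>
  ultimately show "2 * n + (n div N + t (n div N)) < 2 * n' + (n' div N + t (n' div N))"
    by (cases "n div N = n' div N") auto
qed

lemma card_comb:
  assumes "strict_mono y" "\<And>i. t i \<le> 2"
  shows "card (comb y N k (\<lambda>i. i + t i)) = k * N"
proof -
  have "strict_mono (y \<circ> (\<lambda>n. 2 * n + (n div N + t (n div N))))"
    using assms strict_mono_comb_index strict_mono_o by blast
  then have "inj_on (y \<circ> (\<lambda>n. 2 * n + (n div N + t (n div N)))) {..<k * N}"
    using inj_on_subset strict_mono_imp_inj_on by blast
  then show ?thesis
    unfolding comb_def by (simp add: card_image o_def)
qed

lemma card_comb_diff_sym:
  assumes "strict_mono y" "\<And>i. s i \<le> 2" "\<And>i. t i \<le> 2"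
  shows "card (comb y N k (\<lambda>i. i + s i) - comb y N k (\<lambda>i. i + t i))
       = card (comb y N k (\<lambda>i. i + t i) - comb y N k (\<lambda>i. i + s i))"
  using assms by (intro card_le_sym_Diff[THEN order.antisym] card_le_sym_Diff) (auto simp: card_comb)

text \<open>These combs are opposite vertices of the cube; disjointness puts them at the full
  distance 2 after scaling.\<close>

lemma comb_disjoint:
  assumes "strict_mono y"
  shows "comb y N k (\<lambda>i. i + 0) \<inter> comb y N k (\<lambda>i. i + 1) = {}"
proof -
  have "y (2 * n + (n div N + 0)) \<noteq> y (2 * m + (m div N + 1))" for n m
  proof -
    have "n div N \<le> m div N" if "n \<le> m" using that by (simp add: div_le_mono)
    moreover have "m div N \<le> n div N" if "m \<le> n" using that by (simp add: div_le_mono)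
    ultimately have "2 * n + (n div N + 0) \<noteq> 2 * m + (m div N + 1)"
      by (cases n m rule: linorder_cases) auto
    then show ?thesis using strict_mono_eq[OF assms] by blast
  qed
  then show ?thesis unfolding comb_def by blast
qed

lemma card_comb_diff_block:
  assumes "\<And>i. i \<noteq> m \<Longrightarrow> s i = t i"
  shows "card (comb y N k s - comb y N k t) \<le> N"
proof -
  have "comb y N k s - comb y N k t \<subseteq> (\<lambda>j. y (2 * (m * N + j) + s m)) ` {..<N}"
  proof
    fix x assume "x \<in> comb y N k s - comb y N k t"
    then obtain n where n: "n < k * N" "x = y (2 * n + s (n div N))" "x \<notin> comb y N k t"
      by (auto simp: comb_def)
    then have "n div N = m" using assms by (force simp: comb_def)
    moreover have "N > 0" using n by (cases N) auto
    moreover have "n = n div N * N + n mod N" by simp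
    ultimately show "x \<in> (\<lambda>j. y (2 * (m * N + j) + s m)) ` {..<N}"
      using n by (intro image_eqI[of _ _ "n mod N"]) auto
  qed
  then have "card (comb y N k s - comb y N k t) \<le> card ((\<lambda>j. y (2 * (m * N + j) + s m)) ` {..<N})"
    by (intro card_mono) simp_all
  also have "\<dots> \<le> N"
    using card_image_le[of "{..<N}" "(\<lambda>j. y (2 * (m * N + j) + s m))"] by simp
  finally show ?thesis .
qed

text \<open>Shifting a comb by a full period only moves its last tooth.\<close>

lemma card_comb_diff_period:
  assumes "\<And>i. t i = s i \<or> t i = s i + 2"
  shows "card (comb y N k t - comb y N k s) \<le> k"
proof -
  let ?last = "\<lambda>i. y (2 * (i * N + (N - 1)) + t i)"
  have "comb y N k t - comb y N k s \<subseteq> ?last ` {..<k}"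
  proof
    fix x assume "x \<in> comb y N k t - comb y N k s"
    then obtain n where n: "n < k * N" "x = y (2 * n + t (n div N))" "x \<notin> comb y N k s"
      by (auto simp: comb_def)
    have "N > 0" using n by (cases N) auto
    have "t (n div N) \<noteq> s (n div N)" using n by (auto simp: comb_def)
    then have t: "t (n div N) = s (n div N) + 2" using assms by metis
    have "n div N < k" using n by (simp add: less_mult_imp_div_less)
    \<comment> \<open>An offset raised by 2 turns tooth \<open>n\<close> into tooth
      \<open>n + 1\<close> of the unraised comb, provided both lie in the same block.\<close>
    have "n mod N = N - 1"
    proof (rule ccontr)
      assume "n mod N \<noteq> N - 1"
      then have lt: "n mod N + 1 < N" using \<open>N > 0\<close> mod_less_divisor[of N n] by linarith
      have eq: "n + 1 = n div N * N + (n mod N + 1)" by simp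
      have "(n div N * N + (n mod N + 1)) div N = n div N + (n mod N + 1) div N"
        using \<open>N > 0\<close> by (intro div_mult_self3) simp
      then have "(n + 1) div N = n div N"
        using lt eq by simp
      moreover have "n + 1 < k * N"
      proof -
        have "n + 1 < n div N * N + N" using lt eq by linarith
        also have "\<dots> = (n div N + 1) * N" by simp
        also have "\<dots> \<le> k * N" using \<open>n div N < k\<close> by (intro mult_le_mono1) simp
        finally show ?thesis .
      qed
      ultimately have "x \<in> comb y N k s"
        using n t by (auto simp: comb_def intro!: image_eqI[of _ _ "n + 1"])
      with n show False by blast
    qed
    moreover have "n = n div N * N + n mod N" by simp
    ultimately have "x = ?last (n div N)" using n by metis
    then show "x \<in> ?last ` {..<k}" using \<open>n div N < k\<close> by blast
  qed
  then have "card (comb y N k t - comb y N k s) \<le> card (?last ` {..<k})"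
    by (intro card_mono) simp_all
  also have "\<dots> \<le> k"
    using card_image_le[of "{..<k}" "?last"] by simp
  finally show ?thesis .
qed

section \<open>The Ptolemy estimate on the cube\<close>

text \<open>The vertices are embedded so that flipping one of the \<open>k\<close> blocks moves a point by \<open>2 / k\<close>.
  The error terms come from the Ramsey argument and from the last teeth of the blocks.\<close>

lemma snowflake_cube_estimate:
  assumes "Metric_space Y d" and ptol: "ptolemy_inequality Y d"
    and f: "f \<in> l1_unit_ball \<rightarrow> Y" and "q > 0" "c > 1"
    and bounds: "\<And>z z'. z \<in> l1_unit_ball \<Longrightarrow> z' \<in> l1_unit_ball \<Longrightarrow>
        1 / c * l1_dist z z' powr q \<le> d (f z) (f z') \<and> d (f z) (f z') \<le> c * l1_dist z z' powr q"
    and "k > 0" "N > 0" "\<eta> > 0"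
  shows "(1 / c * 2 powr q)\<^sup>2 \<le> real k *
           ((c * (2 / real k) powr q)\<^sup>2 + c * 2 powr q * (2 * \<eta> + c * (2 / real N) powr q))"
proof -
  interpret Metric_space Y d by fact
  \<comment> \<open>A comb has at most \<open>k * N\<close> teeth, so this weight keeps its total
    mass at most 1.\<close>
  define u where "u = 1 / (real k * real N)"
  have u: "u \<ge> 0" "u * (real k * real N) = 1" using \<open>k > 0\<close> \<open>N > 0\<close> by (simp_all add: u_def)
  define P where "P A = (\<lambda>x. u * indicator A x :: real)" for A :: "nat set"
  define dA where "dA A B = d (f (P A)) (f (P B))" for A B
  \<comment> \<open>Upper bounds for \<open>D\<close>: \<open>M\<close> for any two vertices,
    \<open>\<kappa>\<close> for moving one tooth in each block, \<open>a\<close> for flipping one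
    block.\<close>
  define M where "M = c * 2 powr q"
  define \<kappa> where "\<kappa> = c * (2 / real N) powr q"
  define a where "a = c * (2 / real k) powr q"
  have ball: "P A \<in> l1_unit_ball" if "finite A" "card A \<le> k * N" for A
  proof -
    have "real (card A) \<le> real k * real N" using that by (metis of_nat_le_iff of_nat_mult)
    then have "u * real (card A) \<le> 1" using u by (metis mult_left_mono)
    then show ?thesis unfolding P_def using that u by (intro scaled_indicator_in_l1_unit_ball)
  qed
  have upper: "dA A B \<le> c * \<rho> powr q"
    if "finite A" "finite B" "card A \<le> k * N" "card B \<le> k * N"
      "u * real (card (A - B) + card (B - A)) \<le> \<rho>" for A B \<rho>
  proof -
    have "dA A B \<le> c * l1_dist (P A) (P B) powr q"
      unfolding dA_def using bounds ball that by blast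
    also have "l1_dist (P A) (P B) = u * real (card (A - B) + card (B - A))"
      unfolding P_def using that u by (intro l1_dist_scaled_indicator)
    also have "c * (u * real (card (A - B) + card (B - A))) powr q \<le> c * \<rho> powr q"
      using that u \<open>q > 0\<close> \<open>c > 1\<close> by (intro mult_left_mono powr_mono2) auto
    finally show ?thesis .
  qed
  have dA_nonneg: "0 \<le> dA A B" for A B by (simp add: dA_def)
  have dA_le_M: "dA A B \<le> M" if "finite A" "finite B" "card A \<le> k * N" "card B \<le> k * N" for A B
    unfolding M_def
  proof (rule upper[OF that])
    have "card (A - B) \<le> k * N" "card (B - A) \<le> k * N"
      using that by (meson Diff_subset card_mono order.trans)+
    then have "card (A - B) + card (B - A) \<le> 2 * (k * N)" by simp
    then have "real (card (A - B) + card (B - A)) \<le> 2 * (real k * real N)"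
      by (metis of_nat_le_iff of_nat_mult of_nat_numeral)
    then have "u * real (card (A - B) + card (B - A)) \<le> u * (2 * (real k * real N))"
      using u(1) by (rule mult_left_mono)
    then show "u * real (card (A - B) + card (B - A)) \<le> 2" using u(2) by (simp add: algebra_simps)
  qed

  \<comment> \<open>Coordinates start at 0, so flipping coordinate \<open>m\<close> by
    \<open>one m\<close> leads from \<open>low m\<close> to \<open>low (Suc m)\<close>.\<close>
  define low where "low m i = (if i < m then 1 else 0 :: nat)" for m i :: nat
  define one where "one m i = (if i = m then 1 else 0 :: nat)" for m i :: nat
  have le1: "low m i \<le> 1" "one m i \<le> 1" for m i by (simp_all add: low_def one_def)
  \<comment> \<open>Only these \<open>k + 1\<close> functions need stabilising; all other pairs of
    vertices are reached through \<open>block_shift\<close>.\<close>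
  define F where "F m h = dA (comb h N k (low 0)) (comb h N k (low m))" for m h
  obtain y :: "nat \<Rightarrow> nat" where y: "strict_mono y"
    and ramsey: "\<And>m g h. m \<in> {..k} \<Longrightarrow> strict_mono (g :: nat \<Rightarrow> nat) \<Longrightarrow> strict_mono h \<Longrightarrow>
                  \<bar>F m (y \<circ> g) - F m (y \<circ> h)\<bar> \<le> \<eta>"
  proof -
    have "\<exists>y :: nat \<Rightarrow> nat. strict_mono y \<and> (\<forall>m\<in>{..k}. \<forall>g h. strict_mono g \<longrightarrow> strict_mono h \<longrightarrow>
             \<bar>F m (y \<circ> g) - F m (y \<circ> h)\<bar> \<le> \<eta>)"
    proof (rule ramsey_real_sequence_family[where r = "2 * k * N" and M = M])
      show "F m g = F m h" if "\<And>l. l < 2 * k * N \<Longrightarrow> g l = h l" for m g h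
        unfolding F_def using that le1 by (intro arg_cong2[where f = dA] comb_cong)
      show "F m h \<le> M" for m h
        unfolding F_def by (intro dA_le_M) (auto simp: card_comb_le)
    qed (auto simp: F_def dA_nonneg \<open>\<eta> > 0\<close>)
    then show thesis using that by blast
  qed

  \<comment> \<open>The built-in drift \<open>i\<close> is that of \<open>block_shift\<close>: along
    \<open>y \<circ> block_shift N s\<close>, the combs with offsets 0 and \<open>t\<close> become
    \<open>W s\<close> and \<open>W\<close> of the sum of \<open>s\<close> and
    \<open>t\<close>.\<close>
  define W where "W t = comb y N k (\<lambda>i. i + t i)" for t
  define D where "D s t = dA (W s) (W t)" for s t
  have W: "finite (W t)" "card (W t) \<le> k * N" for t
    by (simp_all add: W_def card_comb_le)
  have fW: "f (P (W t)) \<in> Y" for t using f ball[OF W] by blast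
  define v where "v m = D (low 0) (low m)" for m
  have v_nonneg: "0 \<le> v m" and v_le: "v m \<le> M" for m
    unfolding v_def D_def by (auto simp: dA_nonneg intro!: dA_le_M W)
  \<comment> \<open>Approximate translation invariance. Offsets are added in the naturals, not
    modulo 2; \<open>period\<close> later repairs the entries equal to 2.\<close>
  have shifted: "\<bar>D s (\<lambda>i. s i + low m i) - v m\<bar> \<le> \<eta>"
    if "m \<le> k" and s: "\<And>i. s i \<le> 1" for s m
  proof -
    have F: "F m (y \<circ> block_shift N s') = D s' (\<lambda>i. s' i + low m i)" for s'
      unfolding F_def D_def W_def comb_block_shift[OF le1(1)] by (simp add: low_def add.assoc)
    have "F m (y \<circ> block_shift N (low 0)) = v m"
    proof -
      have "(\<lambda>i. low 0 i + low m i) = low m" by (simp add: low_def fun_eq_iff)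
      then show ?thesis unfolding F v_def by simp
    qed
    moreover have "strict_mono (block_shift N s)" "strict_mono (block_shift N (low 0))"
      using s le1 by (blast intro: strict_mono_block_shift)+
    ultimately show ?thesis
      using ramsey[of m "block_shift N s" "block_shift N (low 0)"] F[of s] \<open>m \<le> k\<close> by simp
  qed
  have block: "D s t \<le> a" if "\<And>i. i \<noteq> m \<Longrightarrow> s i = t i" for s t m
    unfolding D_def a_def
  proof (rule upper)
    have "card (W s - W t) \<le> N" "card (W t - W s) \<le> N"
      unfolding W_def using that by (intro card_comb_diff_block[of m]; simp)+
    then have "real (card (W s - W t) + card (W t - W s)) \<le> 2 * real N" by linarith
    then have "u * real (card (W s - W t) + card (W t - W s)) \<le> u * (2 * real N)"
      using u(1) by (rule mult_left_mono)
    also have "\<dots> = 2 / real k" using \<open>N > 0\<close> by (simp add: u_def)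
    finally show "u * real (card (W s - W t) + card (W t - W s)) \<le> 2 / real k" .
  qed (use W in auto)
  have period: "D s t \<le> \<kappa>"
    if "\<And>i. t i = s i \<or> t i = s i + 2" "\<And>i. s i \<le> 2" "\<And>i. t i \<le> 2" for s t
    unfolding D_def \<kappa>_def
  proof (rule upper)
    have "card (W t - W s) \<le> k"
      unfolding W_def using that(1) by (intro card_comb_diff_period) auto
    moreover have "card (W s - W t) = card (W t - W s)"
      unfolding W_def using y that(2,3) by (rule card_comb_diff_sym)
    ultimately have "real (card (W s - W t) + card (W t - W s)) \<le> 2 * real k" by linarith
    then have "u * real (card (W s - W t) + card (W t - W s)) \<le> u * (2 * real k)"
      using u(1) by (rule mult_left_mono)
    also have "\<dots> = 2 / real N" using \<open>k > 0\<close> by (simp add: u_def)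
    finally show "u * real (card (W s - W t) + card (W t - W s)) \<le> 2 / real N" .
  qed (use W in auto)

  have step: "(v (Suc m))\<^sup>2 \<le> (v m)\<^sup>2 + (a\<^sup>2 + M * (2 * \<eta> + \<kappa>))" if "m < k" for m
  proof -
    \<comment> \<open>This sum is 2 below \<open>m\<close>, 1 at \<open>m\<close> and 0 above, hence
      agrees with \<open>one m\<close> modulo 2. So \<open>one m\<close> may replace it at cost
      \<open>\<kappa>\<close>.\<close>
    let ?t = "\<lambda>i. low m i + low (Suc m) i"
    have side: "D (low (Suc m)) (one m) \<le> v m + \<eta>"
    proof -
      have "(\<lambda>i. one m i + low m i) = low (Suc m)" by (auto simp: one_def low_def)
      then have "\<bar>D (one m) (low (Suc m)) - v m\<bar> \<le> \<eta>"
        using shifted[of m "one m"] that le1 by simp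
      then show ?thesis unfolding D_def dA_def by (simp add: commute abs_le_iff)
    qed
    have diag: "v (Suc m) - \<eta> - \<kappa> \<le> D (low m) (one m)"
    proof -
      have "\<bar>D (low m) ?t - v (Suc m)\<bar> \<le> \<eta>"
        using shifted[of "Suc m" "low m"] that le1 by simp
      moreover have "D (low m) ?t \<le> D (low m) (one m) + D (one m) ?t"
        unfolding D_def dA_def by (intro triangle fW)
      moreover have "D (one m) ?t \<le> \<kappa>"
        by (rule period) (auto simp: one_def low_def)
      ultimately show ?thesis by linarith
    qed
    \<comment> \<open>Ptolemy for \<open>low 0\<close>, \<open>low m\<close>,
      \<open>low (Suc m)\<close>, \<open>one m\<close> in this cyclic order.\<close>
    have "v (Suc m) * D (low m) (one m)
        \<le> v m * D (low (Suc m)) (one m) + D (low m) (low (Suc m)) * D (one m) (low 0)"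
      using ptol fW unfolding ptolemy_inequality_def v_def D_def dA_def by blast
    moreover have "v m * D (low (Suc m)) (one m) \<le> v m * (v m + \<eta>)"
      using side v_nonneg by (rule mult_left_mono)
    moreover have "D (low m) (low (Suc m)) * D (one m) (low 0) \<le> a * a"
    proof (rule mult_mono)
      show "D (low m) (low (Suc m)) \<le> a" by (rule block[of m]) (auto simp: low_def)
      show "D (one m) (low 0) \<le> a" by (rule block[of m]) (auto simp: low_def one_def)
    qed (use \<open>c > 1\<close> in \<open>auto simp: D_def dA_nonneg a_def\<close>)
    moreover have "v (Suc m) * (v (Suc m) - \<eta> - \<kappa>) \<le> v (Suc m) * D (low m) (one m)"
      using diag v_nonneg by (rule mult_left_mono)
    moreover have "v m * \<eta> \<le> M * \<eta>"
      using v_le \<open>\<eta> > 0\<close> by (intro mult_right_mono) auto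
    moreover have "v (Suc m) * (\<eta> + \<kappa>) \<le> M * (\<eta> + \<kappa>)"
      using v_le \<open>\<eta> > 0\<close> \<open>c > 1\<close> by (intro mult_right_mono) (auto simp: \<kappa>_def)
    ultimately show ?thesis by (simp add: power2_eq_square algebra_simps)
  qed
  have iterate: "(v m)\<^sup>2 \<le> real m * (a\<^sup>2 + M * (2 * \<eta> + \<kappa>))" if "m \<le> k" for m
    using that
  proof (induction m)
    case 0
    have "v 0 = 0" unfolding v_def D_def dA_def using fW by simp
    then show ?case by simp
  next
    case (Suc m)
    then show ?case using step[of m] by (simp add: algebra_simps)
  qed
  \<comment> \<open>Opposite vertices are disjoint combs of mass 1 each, so their distance in the
    ball is 2.\<close>
  have "1 / c * 2 powr q \<le> v k"
  proof -
    have top: "W (low k) = comb y N k (\<lambda>i. i + 1)"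
      unfolding W_def comb_def using \<open>N > 0\<close>
      by (intro image_cong refl) (auto simp: low_def less_mult_imp_div_less)
    have bot: "W (low 0) = comb y N k (\<lambda>i. i + 0)"
      by (simp add: W_def low_def)
    have disj: "W (low 0) \<inter> W (low k) = {}"
      unfolding top bot using y by (rule comb_disjoint)
    have card_W: "card (W (low m)) = k * N" for m
      unfolding W_def using y by (intro card_comb) (auto simp: low_def)
    have "l1_dist (P (W (low 0))) (P (W (low k)))
        = u * real (card (W (low 0) - W (low k)) + card (W (low k) - W (low 0)))"
      unfolding P_def using W u by (intro l1_dist_scaled_indicator)
    also have "W (low 0) - W (low k) = W (low 0)" using disj by blast
    also have "W (low k) - W (low 0) = W (low k)" using disj by blast
    also have "u * real (card (W (low 0)) + card (W (low k))) = 2"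
      using u(2) by (simp add: card_W algebra_simps)
    finally show ?thesis
      using bounds[OF ball[OF W] ball[OF W], of "low 0" "low k"] by (simp add: v_def D_def dA_def)
  qed
  then have "(1 / c * 2 powr q)\<^sup>2 \<le> (v k)\<^sup>2"
    using \<open>c > 1\<close> by (intro power_mono) auto
  with iterate[of k] show ?thesis by (simp add: a_def M_def \<kappa>_def)
qed

section \<open>Choice of parameters and contradiction\<close>

theorem theorem1p7:
  fixes q :: real and Y :: "'b set" and d :: "'b \<Rightarrow> 'b \<Rightarrow> real"
  assumes "q > 1 / 2"
    and "Metric_space Y d"
    and "ptolemy_inequality Y d"
  shows "\<not> (\<exists>f. snowflake_map q l1_unit_ball l1_dist Y d f)"
proof
  assume "\<exists>f. snowflake_map q l1_unit_ball l1_dist Y d f"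
  then obtain f c where f: "f \<in> l1_unit_ball \<rightarrow> Y" and "c > 1"
    and bounds: "\<And>z z'. z \<in> l1_unit_ball \<Longrightarrow> z' \<in> l1_unit_ball \<Longrightarrow>
        1 / c * l1_dist z z' powr q \<le> d (f z) (f z') \<and> d (f z) (f z') \<le> c * l1_dist z z' powr q"
    unfolding snowflake_map_def by blast
  have "q > 0" using assms by simp
  note cube = snowflake_cube_estimate[OF assms(2,3) f \<open>q > 0\<close> \<open>c > 1\<close> bounds]
  define b where "b = (1 / c * 2 powr q)\<^sup>2"
  define M where "M = c * 2 powr q"
  have "b > 0" using \<open>c > 1\<close> by (simp add: b_def)
  \<comment> \<open>The expression is a constant times \<open>k powr (1 - 2 * q)\<close>; here
    \<open>q > 1 / 2\<close> enters.\<close>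
  have lim_k: "((\<lambda>k. real k * (c * (2 / real k) powr q)\<^sup>2) \<longlongrightarrow> 0) sequentially"
  proof (rule Lim_transform_eventually)
    have "((\<lambda>k. real k powr (1 - 2 * q)) \<longlongrightarrow> 0) sequentially"
      using assms(1) by (intro tendsto_neg_powr filterlim_real_sequentially) simp
    from tendsto_mult_left[OF this, of "(c * 2 powr q)\<^sup>2"]
    show "((\<lambda>k. (c * 2 powr q)\<^sup>2 * real k powr (1 - 2 * q)) \<longlongrightarrow> 0) sequentially" by simp
    show "eventually (\<lambda>k. (c * 2 powr q)\<^sup>2 * real k powr (1 - 2 * q)
        = real k * (c * (2 / real k) powr q)\<^sup>2) sequentially"
      using eventually_gt_at_top[of 0]
    proof eventually_elim
      case (elim k)
      then have "real k powr (1 - 2 * q) = real k / (real k powr q)\<^sup>2"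
        by (simp add: powr_diff powr_add[symmetric] power2_eq_square)
      then show ?case
        using elim by (simp add: powr_divide power_divide power_mult_distrib)
    qed
  qed
  \<comment> \<open>First \<open>k\<close> is fixed to make the main term small. Only then
    \<open>N = Suc n\<close> and \<open>\<eta> = 1 / Suc n\<close> go to their limits, since the
    error terms carry a factor \<open>k\<close>.\<close>
  obtain k where k: "k > 0" "real k * (c * (2 / real k) powr q)\<^sup>2 < b / 2"
    using eventually_happens[OF eventually_conj[OF eventually_gt_at_top[of 0]
      order_tendstoD(2)[OF lim_k, of "b / 2"]]] \<open>b > 0\<close> by auto
  have "b \<le> real k * ((c * (2 / real k) powr q)\<^sup>2
      + M * (2 * (1 / real (Suc n)) + c * (2 / real (Suc n)) powr q))" for n
    unfolding b_def M_def by (rule cube) (use k in auto)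
  moreover have "((\<lambda>n. real k * ((c * (2 / real k) powr q)\<^sup>2
      + M * (2 * (1 / real (Suc n)) + c * (2 / real (Suc n)) powr q)))
      \<longlongrightarrow> real k * (c * (2 / real k) powr q)\<^sup>2) sequentially"
  proof -
    have inv: "((\<lambda>n. w / real (Suc n)) \<longlongrightarrow> 0) sequentially" for w
      using tendsto_mult_left[OF LIMSEQ_inverse_real_of_nat, of w] by (simp add: divide_inverse)
    have "((\<lambda>n. (2 / real (Suc n)) powr q) \<longlongrightarrow> 0) sequentially"
      using \<open>q > 0\<close> by (intro tendsto_zero_powrI[OF inv tendsto_const]) auto
    from tendsto_add[OF tendsto_mult_left[OF inv[of 1], of 2] tendsto_mult_left[OF this, of c]]
    have "((\<lambda>n. 2 * (1 / real (Suc n)) + c * (2 / real (Suc n)) powr q) \<longlongrightarrow> 0) sequentially"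
      by simp
    from tendsto_mult_left[OF tendsto_add[OF tendsto_const tendsto_mult_left[OF this]]]
    show ?thesis by simp
  qed
  ultimately have "b \<le> real k * (c * (2 / real k) powr q)\<^sup>2"
    by (intro Lim_bounded2[where N = 0]) auto
  with k \<open>b > 0\<close> show False by simp
qed

end
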